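(* Let $\mathcal{A}=\{a_1,\ldots,a_n\}\subset\mathbb{Z}^d$ and let $I_{\mathcal{A}}\subset\mathbb{K}[x_1,\ldots,x_n]$ be the corresponding toric ideal. Let $w=(w_1,\ldots,w_n)\in\mathbb{N}^n$ and let $$\mathcal{A}_w:=\{(a_1,w_1),\ldots,(a_n,w_n),(0,\ldots,0,1)\}\subset\mathbb{Z}^{d+1}.$$ Then $I_{\mathcal{A}}(t,w)=I_{\mathcal{A}_w}$ as ideals of $\mathbb{K}[x_1,\ldots,x_n,t]$.
   Context: $\mathbb{K}$ is a field and $\mathbb{N}$ contains $0$. Toric ideals: for a finite set $\mathcal{A}=\{a_1,\ldots,a_n\}\subset\mathbb{Z}^d$, let $\hat\pi_{\mathcal{A}}:\mathbb{K}[x_1,\ldots,x_n]\to\mathbb{K}[z_1^{\pm1},\ldots,z_d^{\pm1}]$ be the $\mathbb{K}$-algebra map $x_i\mapsto z^{a_i}$. The toric ideal of $\mathcal{A}$ is $I_{\mathcal{A}}:=\ker\hat\pi_{\mathcal{A}}$. For $\mathcal{A}_w$ (listed in the order given), the variables are $x_1,\ldots,x_n,t$, where $x_i$ corresponds to $(a_i,w_i)$ and $t$ corresponds to $(0,\ldots,0,1)$. Gröbner degeneration: for a nonzero $f=\sum c_ux^u\in\mathbb{K}[x_1,\ldots,x_n]$ let $d(f):=\max\{w\cdot u\mid c_u\neq0\}$ and $f_t:=t^{d(f)}f(t^{-w_1}x_1,\ldots,t^{-w_n}x_n)\in\mathbb{K}[x_1,\ldots,x_n,t]$ (with $0_t=0$).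 For an ideal $J\subset\mathbb{K}[x_1,\ldots,x_n]$, its Gröbner degeneration with respect to $w$ is the ideal $J(t,w):=\langle f_t\mid f\in J\rangle\subset\mathbb{K}[x_1,\ldots,x_n,t]$. *)

theory Defs
  imports "HOL-Algebra.RingHom" "HOL-Library.Poly_Mapping"
begin

text \<open>
  Variables and coordinates are indexed from \<open>0\<close>: in a ring with \<open>m\<close> variables these are the
  indices \<open>0, \<dots>, m - 1\<close>. Elements of \<open>\<nat>\<^sup>m\<close> and of \<open>\<int>\<^sup>m\<close> are the finitely supported functions on
  \<^typ>\<open>nat\<close> whose support lies below \<open>m\<close>. The multiplication of \<^typ>\<open>'e \<Rightarrow>\<^sub>0 'k\<close> is the
  convolution product, so exponents in \<open>\<nat>\<^sup>m\<close> give the polynomial ring and exponents in \<open>\<int>\<^sup>m\<close>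
  the ring of Laurent polynomials.
\<close>

definition exponents :: "nat \<Rightarrow> (nat \<Rightarrow>\<^sub>0 'e::zero) set" where
  "exponents m = {u. Poly_Mapping.keys u \<subseteq> {..<m}}"

definition exponent_algebra ::
    "nat \<Rightarrow> ((nat \<Rightarrow>\<^sub>0 'e::comm_monoid_add) \<Rightarrow>\<^sub>0 'k::field) ring" where
  "exponent_algebra m =
    \<lparr>carrier = {f. Poly_Mapping.keys f \<subseteq> exponents m},
     mult = (*), one = 1, zero = 0, add = (+)\<rparr>"

abbreviation poly_ring :: "nat \<Rightarrow> ((nat \<Rightarrow>\<^sub>0 nat) \<Rightarrow>\<^sub>0 'k::field) ring" where
  "poly_ring \<equiv> exponent_algebra"

abbreviation laurent_ring :: "nat \<Rightarrow> ((nat \<Rightarrow>\<^sub>0 int) \<Rightarrow>\<^sub>0 'k::field) ring" where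
  "laurent_ring \<equiv> exponent_algebra"

text \<open>
  \<open>poly_subst s\<close> is the \<open>\<K>\<close>-algebra map sending the \<open>i\<close>-th variable to \<open>s i\<close>; the scalar \<open>c\<close>
  is \<^term>\<open>Poly_Mapping.single 0 c\<close>.
\<close>

definition poly_subst ::
    "(nat \<Rightarrow> ('m::comm_monoid_add \<Rightarrow>\<^sub>0 'k::field)) \<Rightarrow> ((nat \<Rightarrow>\<^sub>0 nat) \<Rightarrow>\<^sub>0 'k) \<Rightarrow> ('m \<Rightarrow>\<^sub>0 'k)" where
  "poly_subst s f =
    (\<Sum>u\<in>Poly_Mapping.keys f. Poly_Mapping.single 0 (Poly_Mapping.lookup f u) *
       (\<Prod>i\<in>Poly_Mapping.keys u. s i ^ Poly_Mapping.lookup u i))"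

definition toric_map ::
    "(nat \<Rightarrow> (nat \<Rightarrow>\<^sub>0 int)) \<Rightarrow> ((nat \<Rightarrow>\<^sub>0 nat) \<Rightarrow>\<^sub>0 'k::field) \<Rightarrow> ((nat \<Rightarrow>\<^sub>0 int) \<Rightarrow>\<^sub>0 'k)" where
  "toric_map a = poly_subst (\<lambda>i. Poly_Mapping.single (a i) 1)"

text \<open>
  A configuration in \<open>\<int>\<^sup>d\<close> is a listed family \<open>a 0, \<dots>, a (n - 1)\<close>; there is one variable for
  each member of the list, also if a vector is listed twice.
\<close>

definition toric_ideal ::
    "nat \<Rightarrow> nat \<Rightarrow> (nat \<Rightarrow> (nat \<Rightarrow>\<^sub>0 int)) \<Rightarrow> ((nat \<Rightarrow>\<^sub>0 nat) \<Rightarrow>\<^sub>0 'k::field) set" where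
  "toric_ideal d n a = a_kernel (poly_ring n) (laurent_ring d) (toric_map a)"

text \<open>The new coordinate of \<open>\<int>\<^bsup>d+1\<^esup>\<close> has index \<open>d\<close>.\<close>

definition weighted_config ::
    "nat \<Rightarrow> nat \<Rightarrow> (nat \<Rightarrow> (nat \<Rightarrow>\<^sub>0 int)) \<Rightarrow> (nat \<Rightarrow> nat) \<Rightarrow> (nat \<Rightarrow> (nat \<Rightarrow>\<^sub>0 int))" where
  "weighted_config d n a w i =
    (if i < n then a i + Poly_Mapping.single d (int (w i)) else Poly_Mapping.single d 1)"

definition weight :: "nat \<Rightarrow> (nat \<Rightarrow> nat) \<Rightarrow> (nat \<Rightarrow>\<^sub>0 nat) \<Rightarrow> nat" where
  "weight n w u = (\<Sum>i<n. w i * Poly_Mapping.lookup u i)"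

definition weight_degree ::
    "nat \<Rightarrow> (nat \<Rightarrow> nat) \<Rightarrow> ((nat \<Rightarrow>\<^sub>0 nat) \<Rightarrow>\<^sub>0 'k::field) \<Rightarrow> nat" where
  "weight_degree n w f = Max (weight n w ` Poly_Mapping.keys f)"

text \<open>
  The polynomial \<open>f\<^sub>t\<close>, where \<open>t\<close> is the variable of index \<open>n\<close>: with \<open>D = weight_degree n w f\<close>,
  expanding \<open>t\<^bsup>D\<^esup> f(t\<^bsup>-w 0\<^esup> x\<^sub>0, t\<^bsup>-w 1\<^esup> x\<^sub>1, \<dots>)\<close> replaces each term \<open>c x\<^sup>u\<close> of \<open>f\<close> by
  \<open>c x\<^sup>u t\<^bsup>D - weight n w u\<^esup>\<close>. The subtraction never truncates, and for \<open>f = 0\<close> the sum is empty.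
  The lemma \<open>homogenize_eq_subst\<close> below recovers the unexpanded formula.
\<close>

definition homogenize ::
    "nat \<Rightarrow> (nat \<Rightarrow> nat) \<Rightarrow> ((nat \<Rightarrow>\<^sub>0 nat) \<Rightarrow>\<^sub>0 'k::field) \<Rightarrow> ((nat \<Rightarrow>\<^sub>0 nat) \<Rightarrow>\<^sub>0 'k)" where
  "homogenize n w f =
    (\<Sum>u\<in>Poly_Mapping.keys f.
       Poly_Mapping.single
         (u + Poly_Mapping.single n (weight_degree n w f - weight n w u))
         (Poly_Mapping.lookup f u))"

definition groebner_degeneration ::
    "nat \<Rightarrow> (nat \<Rightarrow> nat) \<Rightarrow> ((nat \<Rightarrow>\<^sub>0 nat) \<Rightarrow>\<^sub>0 'k::field) set \<Rightarrow> ((nat \<Rightarrow>\<^sub>0 nat) \<Rightarrow>\<^sub>0 'k) set" where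
  "groebner_degeneration n w J = Idl\<^bsub>poly_ring (Suc n)\<^esub> (homogenize n w ` J)"


lemma exponents_0 [simp]: "0 \<in> exponents m"
  by (simp add: exponents_def)

lemma exponents_add:
  "u \<in> exponents m \<Longrightarrow> v \<in> exponents m \<Longrightarrow> u + v \<in> exponents m"
  for u v :: "nat \<Rightarrow>\<^sub>0 'e::comm_monoid_add"
  unfolding exponents_def using Poly_Mapping.keys_add[of u v] by auto

lemma exponents_sum:
  "(\<And>x. x \<in> A \<Longrightarrow> h x \<in> exponents m) \<Longrightarrow> sum h A \<in> exponents m"
  for h :: "_ \<Rightarrow> nat \<Rightarrow>\<^sub>0 'e::comm_monoid_add"
  by (induction A rule: infinite_finite_induct) (auto intro: exponents_add)

lemma carrier_add:
  "Poly_Mapping.keys f \<subseteq> exponents m \<Longrightarrow> Poly_Mapping.keys g \<subseteq> exponents m \<Longrightarrow>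
    Poly_Mapping.keys (f + g) \<subseteq> exponents m"
  using Poly_Mapping.keys_add[of f g] by blast

lemma carrier_mult:
  fixes f g :: "(nat \<Rightarrow>\<^sub>0 'e::comm_monoid_add) \<Rightarrow>\<^sub>0 'k::field"
  assumes "Poly_Mapping.keys f \<subseteq> exponents m" "Poly_Mapping.keys g \<subseteq> exponents m"
  shows "Poly_Mapping.keys (f * g) \<subseteq> exponents m"
proof
  fix x assume "x \<in> Poly_Mapping.keys (f * g)"
  then obtain u v where "x = u + v" "u \<in> Poly_Mapping.keys f" "v \<in> Poly_Mapping.keys g"
    using keys_mult[of f g] by blast
  then show "x \<in> exponents m"
    using assms exponents_add by blast
qed

lemma carrier_sum:
  "(\<And>x. x \<in> A \<Longrightarrow> Poly_Mapping.keys (h x) \<subseteq> exponents m) \<Longrightarrow>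
    Poly_Mapping.keys (sum h A) \<subseteq> exponents m"
  by (induction A rule: infinite_finite_induct) (simp_all add: carrier_add)

lemma cring_exponent_algebra:
  "cring (exponent_algebra m :: ((nat \<Rightarrow>\<^sub>0 'e::comm_monoid_add) \<Rightarrow>\<^sub>0 'k::field) ring)"
    (is "cring ?R")
proof (rule cringI)
  show "abelian_group ?R"
  proof (rule abelian_groupI)
    fix f assume f: "f \<in> carrier ?R"
    have "Poly_Mapping.keys (- f) = Poly_Mapping.keys f"
      by (auto simp: in_keys_iff)
    then have "- f \<in> carrier ?R" using f by (simp add: exponent_algebra_def)
    then show "\<exists>g\<in>carrier ?R. g \<oplus>\<^bsub>?R\<^esub> f = \<zero>\<^bsub>?R\<^esub>"
      by (intro bexI[of _ "- f"]) (simp_all add: exponent_algebra_def)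
  qed (simp_all add: exponent_algebra_def add_ac carrier_add)
  show "comm_monoid ?R"
    by (rule comm_monoidI)
      (simp_all add: exponent_algebra_def mult_ac carrier_mult)
qed (simp add: exponent_algebra_def distrib_right)

lemma poly_subst_superset:
  assumes "finite A" "Poly_Mapping.keys f \<subseteq> A"
  shows "poly_subst s f =
    (\<Sum>u\<in>A. Poly_Mapping.single 0 (Poly_Mapping.lookup f u) *
       (\<Prod>i\<in>Poly_Mapping.keys u. s i ^ Poly_Mapping.lookup u i))"
  unfolding poly_subst_def
  by (rule sum.mono_neutral_left) (use assms in \<open>auto simp: in_keys_iff\<close>)

lemma poly_subst_0 [simp]: "poly_subst s 0 = 0"
  by (simp add: poly_subst_def)

lemma poly_subst_add: "poly_subst s (f + g) = poly_subst s f + poly_subst s g"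
proof -
  let ?A = "Poly_Mapping.keys f \<union> Poly_Mapping.keys g"
  show ?thesis
    using Poly_Mapping.keys_add[of f g]
    by (simp add: poly_subst_superset[of ?A] lookup_add single_add distrib_right sum.distrib)
qed

lemma poly_subst_sum: "poly_subst s (sum h A) = (\<Sum>x\<in>A. poly_subst s (h x))"
  by (induction A rule: infinite_finite_induct) (simp_all add: poly_subst_add)

lemma poly_subst_single:
  "poly_subst s (Poly_Mapping.single u c) =
    Poly_Mapping.single 0 c * (\<Prod>i\<in>Poly_Mapping.keys u. s i ^ Poly_Mapping.lookup u i)"
  by (subst poly_subst_superset[of "{u}"]) auto

lemma prod_keys_superset:
  assumes "finite A" "Poly_Mapping.keys u \<subseteq> A"
  shows "(\<Prod>i\<in>Poly_Mapping.keys u. s i ^ Poly_Mapping.lookup u i) =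
    (\<Prod>i\<in>A. (s i :: 'r::comm_monoid_mult) ^ Poly_Mapping.lookup u i)"
  by (rule prod.mono_neutral_left) (use assms in \<open>auto simp: in_keys_iff\<close>)

lemma prod_keys_add:
  "(\<Prod>i\<in>Poly_Mapping.keys (u + v). s i ^ Poly_Mapping.lookup (u + v) i) =
    (\<Prod>i\<in>Poly_Mapping.keys u. s i ^ Poly_Mapping.lookup u i) *
    (\<Prod>i\<in>Poly_Mapping.keys v. (s i :: 'r::comm_monoid_mult) ^ Poly_Mapping.lookup v i)"
proof -
  let ?A = "Poly_Mapping.keys u \<union> Poly_Mapping.keys v"
  have *: "(\<Prod>i\<in>Poly_Mapping.keys x. s i ^ Poly_Mapping.lookup x i) =
      (\<Prod>i\<in>?A. s i ^ Poly_Mapping.lookup x i)" if "x \<in> {u, v, u + v}" for x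
    using that Poly_Mapping.keys_add[of u v] by (intro prod_keys_superset) auto
  show ?thesis
    unfolding *[of u, simplified] *[of v, simplified] *[of "u + v", simplified]
    by (simp add: lookup_add power_add prod.distrib)
qed

lemma sum_singles:
  "f = (\<Sum>u\<in>Poly_Mapping.keys f. Poly_Mapping.single u (Poly_Mapping.lookup f u))"
  by (rule poly_mapping_eqI) (auto simp: lookup_sum lookup_single when_def in_keys_iff)

lemma poly_subst_mult:
  fixes s :: "nat \<Rightarrow> ('m::comm_monoid_add \<Rightarrow>\<^sub>0 'k::field)"
  shows "poly_subst s (f * g) = poly_subst s f * poly_subst s g"
proof -
  let ?f = "\<lambda>u. Poly_Mapping.single u (Poly_Mapping.lookup f u)"
  let ?g = "\<lambda>v. Poly_Mapping.single v (Poly_Mapping.lookup g v)"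
  have single: "poly_subst s (Poly_Mapping.single u b * Poly_Mapping.single v c) =
      poly_subst s (Poly_Mapping.single u b) * poly_subst s (Poly_Mapping.single v c)" for u v b c
  proof -
    have "Poly_Mapping.single (0::'m) (b * c) = Poly_Mapping.single 0 b * Poly_Mapping.single 0 c"
      by (simp add: mult_single)
    then show ?thesis
      unfolding mult_single[of u] poly_subst_single prod_keys_add by (simp only: mult_ac)
  qed
  have "f * g = (\<Sum>u\<in>Poly_Mapping.keys f. \<Sum>v\<in>Poly_Mapping.keys g. ?f u * ?g v)"
    unfolding sum_product[symmetric] sum_singles[symmetric] ..
  then have "poly_subst s (f * g) =
      (\<Sum>u\<in>Poly_Mapping.keys f. \<Sum>v\<in>Poly_Mapping.keys g.
        poly_subst s (?f u) * poly_subst s (?g v))"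
    by (simp only: poly_subst_sum single)
  also have "\<dots> = poly_subst s (\<Sum>u\<in>Poly_Mapping.keys f. ?f u) *
      poly_subst s (\<Sum>v\<in>Poly_Mapping.keys g. ?g v)"
    by (simp only: poly_subst_sum sum_product)
  finally show ?thesis
    by (simp only: sum_singles[symmetric])
qed

lemma poly_subst_const [simp]: "poly_subst s (Poly_Mapping.single 0 c) = Poly_Mapping.single 0 c"
  by (simp add: poly_subst_single)

lemma poly_subst_1 [simp]: "poly_subst s 1 = 1"
  using poly_subst_const[of s 1] by simp

lemma poly_subst_var [simp]:
  "poly_subst s (Poly_Mapping.single (Poly_Mapping.single i 1) 1) = s i"
  by (simp add: poly_subst_single)

lemma carrier_power:
  fixes f :: "(nat \<Rightarrow>\<^sub>0 'e::comm_monoid_add) \<Rightarrow>\<^sub>0 'k::field"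
  shows "Poly_Mapping.keys f \<subseteq> exponents m \<Longrightarrow> Poly_Mapping.keys (f ^ j) \<subseteq> exponents m"
  by (induction j) (simp_all add: carrier_mult)

lemma carrier_prod:
  fixes h :: "_ \<Rightarrow> (nat \<Rightarrow>\<^sub>0 'e::comm_monoid_add) \<Rightarrow>\<^sub>0 'k::field"
  shows "(\<And>x. x \<in> A \<Longrightarrow> Poly_Mapping.keys (h x) \<subseteq> exponents m) \<Longrightarrow>
    Poly_Mapping.keys (prod h A) \<subseteq> exponents m"
  by (induction A rule: infinite_finite_induct) (simp_all add: carrier_mult)

lemma toric_map_closed:
  fixes f :: "_ \<Rightarrow>\<^sub>0 'k::field"
  assumes "\<And>i. i < n \<Longrightarrow> a i \<in> exponents d" "f \<in> carrier (poly_ring n)"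
  shows "toric_map a f \<in> carrier (laurent_ring d)"
proof -
  have "a i \<in> exponents d" if "u \<in> Poly_Mapping.keys f" "i \<in> Poly_Mapping.keys u" for u i
    using assms that by (auto simp: exponent_algebra_def exponents_def)
  then have "Poly_Mapping.keys (\<Prod>i\<in>Poly_Mapping.keys u.
      Poly_Mapping.single (a i) (1::'k) ^ Poly_Mapping.lookup u i) \<subseteq> exponents d"
    if "u \<in> Poly_Mapping.keys f" for u
    using that by (intro carrier_prod carrier_power) simp
  moreover have "Poly_Mapping.keys (Poly_Mapping.single (0 :: nat \<Rightarrow>\<^sub>0 int) (c::'k)) \<subseteq> exponents d" for c
    by simp
  ultimately have "Poly_Mapping.keys (toric_map a f) \<subseteq> exponents d"
    unfolding toric_map_def poly_subst_def by (intro carrier_sum carrier_mult)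
  then show ?thesis
    by (simp add: exponent_algebra_def)
qed

lemma toric_map_ring_hom:
  assumes "\<And>i. i < n \<Longrightarrow> a i \<in> exponents d"
  shows "ring_hom_ring (poly_ring n) (laurent_ring d :: (_ \<Rightarrow>\<^sub>0 'k::field) ring) (toric_map a)"
proof (rule ring_hom_ringI)
  show "ring (poly_ring n :: (_ \<Rightarrow>\<^sub>0 'k) ring)" "ring (laurent_ring d :: (_ \<Rightarrow>\<^sub>0 'k) ring)"
    by (rule cring.axioms(1)[OF cring_exponent_algebra])+
  show "toric_map a f \<in> carrier (laurent_ring d)" if "f \<in> carrier (poly_ring n)"
    for f :: "_ \<Rightarrow>\<^sub>0 'k"
    using assms that by (rule toric_map_closed)
qed (simp_all add: toric_map_def poly_subst_add poly_subst_mult exponent_algebra_def)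

lemma ideal_toric_ideal:
  assumes "\<And>i. i < n \<Longrightarrow> a i \<in> exponents d"
  shows "ideal (toric_ideal d n a :: (_ \<Rightarrow>\<^sub>0 'k::field) set) (poly_ring n)"
  unfolding toric_ideal_def
  by (rule ring_hom_ring.kernel_is_ideal[OF toric_map_ring_hom[OF assms]])

lemma homogenize_closed:
  assumes "f \<in> carrier (poly_ring n)"
  shows "homogenize n w f \<in> carrier (poly_ring (Suc n))"
proof -
  have "u + Poly_Mapping.single n e \<in> exponents (Suc n)" if "u \<in> Poly_Mapping.keys f" for u e
  proof (rule exponents_add)
    have "Poly_Mapping.keys u \<subseteq> {..<n}"
      using assms that by (auto simp: exponent_algebra_def exponents_def)
    then show "u \<in> exponents (Suc n)"
      by (auto simp: exponents_def)
  qed (simp add: exponents_def)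
  then show ?thesis
    unfolding homogenize_def exponent_algebra_def partial_object.simps mem_Collect_eq
    by (intro carrier_sum) (auto split: if_splits)
qed

text \<open>
  The identity \<open>f\<^sub>t = t\<^bsup>D\<^esup> f(t\<^bsup>-w 0\<^esup> x\<^sub>0, t\<^bsup>-w 1\<^esup> x\<^sub>1, \<dots>)\<close> in the Laurent polynomials in
  \<open>x\<^sub>0, \<dots>, x\<^bsub>n-1\<^esub>, t\<close>; \<^term>\<open>poly_subst X\<close> is the inclusion of polynomials in Laurent polynomials.
\<close>

lemma homogenize_eq_subst:
  fixes f :: "(nat \<Rightarrow>\<^sub>0 nat) \<Rightarrow>\<^sub>0 'k::field"
  assumes "f \<in> carrier (poly_ring n)"
  defines "X \<equiv> \<lambda>i. Poly_Mapping.single (Poly_Mapping.single i (1::int)) (1::'k)"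
  shows "poly_subst X (homogenize n w f) =
    Poly_Mapping.single (Poly_Mapping.single n (int (weight_degree n w f))) 1 *
    poly_subst (\<lambda>i. Poly_Mapping.single (Poly_Mapping.single n (- int (w i))) 1 * X i) f"
proof -
  define T where "T k = Poly_Mapping.single (Poly_Mapping.single n k) (1::'k)" for k :: int
  define P where
    "P u = (\<Prod>i\<in>Poly_Mapping.keys u. X i ^ Poly_Mapping.lookup u i)" for u :: "nat \<Rightarrow>\<^sub>0 nat"
  define D where "D = weight_degree n w f"
  have T_0: "T 0 = 1"
    by (simp add: T_def)
  have T_add: "T j * T k = T (j + k)" for j k
    by (simp add: T_def mult_single single_add)
  have T_power: "T k ^ e = T (int e * k)" for k e
    by (induction e) (simp_all add: T_0 T_add algebra_simps)
  have T_prod: "(\<Prod>i\<in>A. T (h i)) = T (\<Sum>i\<in>A. h i)" for h and A :: "nat set"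
    by (induction A rule: infinite_finite_induct) (simp_all add: T_0 T_add)
  have P_t: "P (Poly_Mapping.single n e) = T (int e)" for e
    using T_power[of 1 e] T_0 by (cases "e = 0") (simp_all add: P_def X_def T_def)
  have weights: "(\<Prod>i\<in>Poly_Mapping.keys u. T (- int (w i)) ^ Poly_Mapping.lookup u i) =
      T (- int (weight n w u))" if "u \<in> Poly_Mapping.keys f" for u
  proof -
    have "Poly_Mapping.keys u \<subseteq> {..<n}"
      using assms(1) that by (auto simp: exponent_algebra_def exponents_def)
    then have "(\<Prod>i\<in>Poly_Mapping.keys u. T (- int (w i)) ^ Poly_Mapping.lookup u i) =
        (\<Prod>i<n. T (- int (w i)) ^ Poly_Mapping.lookup u i)"
      by (intro prod_keys_superset) auto
    also have "\<dots> = T (- int (weight n w u))"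
      by (simp add: T_power T_prod weight_def sum_negf mult.commute)
    finally show ?thesis .
  qed
  have le: "weight n w u \<le> D" if "u \<in> Poly_Mapping.keys f" for u
    using that by (simp add: D_def weight_degree_def)
  have "poly_subst X (homogenize n w f) =
      (\<Sum>u\<in>Poly_Mapping.keys f. Poly_Mapping.single 0 (Poly_Mapping.lookup f u) *
        (P u * P (Poly_Mapping.single n (D - weight n w u))))"
    unfolding homogenize_def poly_subst_sum poly_subst_single prod_keys_add P_def D_def ..
  also have "\<dots> = (\<Sum>u\<in>Poly_Mapping.keys f. Poly_Mapping.single 0 (Poly_Mapping.lookup f u) *
        (P u * (T (int D) * T (- int (weight n w u)))))"
    using le by (intro sum.cong) (simp_all add: P_t T_add of_nat_diff)
  also have "\<dots> = (\<Sum>u\<in>Poly_Mapping.keys f. T (int D) *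
        (Poly_Mapping.single 0 (Poly_Mapping.lookup f u) *
         (\<Prod>i\<in>Poly_Mapping.keys u. (T (- int (w i)) * X i) ^ Poly_Mapping.lookup u i)))"
  proof (rule sum.cong)
    fix u assume u: "u \<in> Poly_Mapping.keys f"
    have "(\<Prod>i\<in>Poly_Mapping.keys u. (T (- int (w i)) * X i) ^ Poly_Mapping.lookup u i) =
        T (- int (weight n w u)) * P u"
      by (simp only: power_mult_distrib prod.distrib weights[OF u] P_def)
    then show "Poly_Mapping.single 0 (Poly_Mapping.lookup f u) *
        (P u * (T (int D) * T (- int (weight n w u)))) = T (int D) *
        (Poly_Mapping.single 0 (Poly_Mapping.lookup f u) *
         (\<Prod>i\<in>Poly_Mapping.keys u. (T (- int (w i)) * X i) ^ Poly_Mapping.lookup u i))"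
      by (simp only: mult_ac)
  qed simp
  also have "\<dots> = T (int D) * poly_subst (\<lambda>i. T (- int (w i)) * X i) f"
    by (simp only: poly_subst_def sum_distrib_left)
  finally show ?thesis
    by (simp only: T_def D_def)
qed

end

(* The toric map sends each monomial to a monomial: it relabels x^u by the degree of u and adds up
   the coefficients in each fibre. For a polynomial in its kernel, moving every term to a chosen
   representative of its fibre therefore gives 0, so the polynomial is a combination of binomials
   x^u - x^v with u and v of equal degree. For the weighted configuration such a binomial is a
   power of t times the homogenization of a binomial in the original toric ideal. *)

theory Submission
  imports Defs
begin

section \<open>Linear extension of a map of exponents\<close>

text \<open>The linear extension of \<open>h\<close> to formal sums. The types are general because
  it serves both as the toric map and as the move to chosen representatives of the fibres.\<close>

definition pushforward :: "('a \<Rightarrow> 'b) \<Rightarrow> ('a \<Rightarrow>\<^sub>0 'k::comm_monoid_add) \<Rightarrow> ('b \<Rightarrow>\<^sub>0 'k)" where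
  "pushforward h f =
    (\<Sum>u\<in>Poly_Mapping.keys f. Poly_Mapping.single (h u) (Poly_Mapping.lookup f u))"

lemma pushforward_superset:
  assumes "finite A" "Poly_Mapping.keys f \<subseteq> A"
  shows "pushforward h f = (\<Sum>u\<in>A. Poly_Mapping.single (h u) (Poly_Mapping.lookup f u))"
  unfolding pushforward_def
  by (rule sum.mono_neutral_left) (use assms in \<open>auto simp: in_keys_iff\<close>)

lemma pushforward_0 [simp]: "pushforward h 0 = 0"
  by (simp add: pushforward_def)

lemma pushforward_single [simp]:
  "pushforward h (Poly_Mapping.single u c) = Poly_Mapping.single (h u) c"
  by (subst pushforward_superset[of "{u}"]) auto

lemma pushforward_add: "pushforward h (f + g) = pushforward h f + pushforward h g"
proof -
  let ?A = "Poly_Mapping.keys f \<union> Poly_Mapping.keys g"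
  show ?thesis
    using Poly_Mapping.keys_add[of f g]
    by (simp add: pushforward_superset[of ?A] lookup_add single_add sum.distrib)
qed

lemma pushforward_sum: "pushforward h (sum F A) = (\<Sum>x\<in>A. pushforward h (F x))"
  by (induction A rule: infinite_finite_induct) (simp_all add: pushforward_add)

text \<open>Terms may cancel in \<open>pushforward k f\<close>, so its keys are not known. On the
  left only the inner sum is expanded; additivity carries \<open>h\<close> through it.\<close>

lemma pushforward_pushforward:
  "pushforward h (pushforward k f) = pushforward (\<lambda>u. h (k u)) f"
  by (simp only: pushforward_def[of k f] pushforward_sum pushforward_single
      pushforward_def[of "\<lambda>u. h (k u)"])

section \<open>Degrees of monomials and the toric map\<close>

text \<open>The exponent of z in the image of x^u. The product is convolution, in which
  \<open>of_nat k\<close> is the constant k, so each summand is an integer multiple of the vector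
  \<open>a i\<close>.\<close>

definition config_degree :: "(nat \<Rightarrow> (nat \<Rightarrow>\<^sub>0 int)) \<Rightarrow> (nat \<Rightarrow>\<^sub>0 nat) \<Rightarrow> (nat \<Rightarrow>\<^sub>0 int)" where
  "config_degree a u = (\<Sum>i\<in>Poly_Mapping.keys u. of_nat (Poly_Mapping.lookup u i) * a i)"

lemma config_degree_superset:
  assumes "finite A" "Poly_Mapping.keys u \<subseteq> A"
  shows "config_degree a u = (\<Sum>i\<in>A. of_nat (Poly_Mapping.lookup u i) * a i)"
  unfolding config_degree_def
  by (rule sum.mono_neutral_left) (use assms in \<open>auto simp: in_keys_iff\<close>)

lemma exponents_of_nat_mult:
  fixes v :: "nat \<Rightarrow>\<^sub>0 'e::comm_semiring_1"
  shows "v \<in> exponents m \<Longrightarrow> of_nat k * v \<in> exponents m"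
  by (induction k) (simp_all add: distrib_right exponents_add)

lemma exponents_mono: "m \<le> n \<Longrightarrow> exponents m \<subseteq> exponents n"
  by (auto simp: exponents_def)

lemma config_degree_closed:
  assumes "\<And>i. i < n \<Longrightarrow> a i \<in> exponents d" "u \<in> exponents n"
  shows "config_degree a u \<in> exponents d"
  unfolding config_degree_def
  using assms by (intro exponents_sum exponents_of_nat_mult) (auto simp: exponents_def)

text \<open>Products and powers of Laurent monomials are monomials whose exponents add up, so x^u is
  sent to the one monomial given by its degree.\<close>

lemma toric_map_eq_pushforward: "toric_map a f = pushforward (config_degree a) f"
proof -
  have power: "Poly_Mapping.single v (1::'a) ^ k = Poly_Mapping.single (of_nat k * v) 1"
    for v :: "nat \<Rightarrow>\<^sub>0 int" and k
    by (induction k) (simp_all add: mult_single distrib_right)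
  have prod: "(\<Prod>i\<in>A. Poly_Mapping.single (h i) (1::'a)) = Poly_Mapping.single (sum h A) 1"
    for h :: "nat \<Rightarrow> nat \<Rightarrow>\<^sub>0 int" and A
    by (induction A rule: infinite_finite_induct) (simp_all add: mult_single)
  show ?thesis
    unfolding toric_map_def poly_subst_def pushforward_def config_degree_def
    by (simp add: power prod mult_single)
qed

lemma in_toric_ideal_iff:
  "f \<in> toric_ideal d n a \<longleftrightarrow>
    Poly_Mapping.keys f \<subseteq> exponents n \<and> pushforward (config_degree a) f = 0"
  by (simp add: toric_ideal_def a_kernel_def' exponent_algebra_def toric_map_eq_pushforward)

section \<open>The weighted configuration\<close>

lemma weighted_config_closed:
  assumes "\<And>i. i < n \<Longrightarrow> a i \<in> exponents d"
  shows "weighted_config d n a w i \<in> exponents (Suc d)"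
proof -
  have "Poly_Mapping.single d c \<in> exponents (Suc d)" for c :: int
    by (simp add: exponents_def)
  moreover have "a i \<in> exponents (Suc d)" if "i < n"
    using assms[OF that] exponents_mono[of d "Suc d"] by auto
  ultimately show ?thesis
    by (simp add: weighted_config_def exponents_add)
qed

lemma of_nat_mult_single:
  "of_nat k * Poly_Mapping.single i c = Poly_Mapping.single i (of_nat k * c)"
  for c :: "'e::comm_semiring_1" and i :: "'i::monoid_add"
  by (induction k) (simp_all add: distrib_right single_add)

text \<open>Each variable of index \<open>i < n\<close> contributes \<open>w i\<close> to the new
  coordinate and t contributes 1, while t does not touch the old coordinates.\<close>

lemma config_degree_weighted_config:
  assumes "u \<in> exponents n"
  shows "config_degree (weighted_config d n a w) (u + Poly_Mapping.single n j) =
    config_degree a u + Poly_Mapping.single d (int (weight n w u + j))"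
proof -
  have keys: "Poly_Mapping.keys u \<subseteq> {..<n}"
    using assms by (simp add: exponents_def)
  then have zero: "Poly_Mapping.lookup u n = 0"
    by (auto simp: in_keys_iff)
  have single_sum: "(\<Sum>i\<in>A. Poly_Mapping.single d (h i)) = Poly_Mapping.single d (sum h A)"
    for h :: "nat \<Rightarrow> int" and A
    by (induction A rule: infinite_finite_induct) (simp_all add: single_add)
  have "Poly_Mapping.keys (u + Poly_Mapping.single n j) \<subseteq> {..<Suc n}"
    using Poly_Mapping.keys_add[of u "Poly_Mapping.single n j"] keys
    by (fastforce split: if_splits)
  then have "config_degree (weighted_config d n a w) (u + Poly_Mapping.single n j) =
      (\<Sum>i<Suc n. of_nat (Poly_Mapping.lookup (u + Poly_Mapping.single n j) i) *
        weighted_config d n a w i)"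
    by (intro config_degree_superset) auto
  also have "\<dots> = (\<Sum>i<n. of_nat (Poly_Mapping.lookup u i) * a i +
        Poly_Mapping.single d (int (w i * Poly_Mapping.lookup u i))) + Poly_Mapping.single d (int j)"
    by (simp add: zero weighted_config_def lookup_add lookup_single of_nat_mult_single
        distrib_left mult.commute)
  also have "\<dots> = config_degree a u + Poly_Mapping.single d (int (weight n w u + j))"
    using keys
    by (simp add: config_degree_superset[of "{..<n}"] sum.distrib single_sum weight_def
        single_add of_nat_sum)
  finally show ?thesis .
qed

lemma exponents_Suc_decompose:
  assumes "u \<in> exponents (Suc n)"
  obtains v j where "v \<in> exponents n" "u = v + Poly_Mapping.single n (j::nat)"
proof
  \<comment> \<open>Truncated subtraction clears coordinate \<open>n\<close>, the exponent of t, and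
    leaves the others unchanged.\<close>
  let ?v = "u - Poly_Mapping.single n (Poly_Mapping.lookup u n)"
  show "?v \<in> exponents n"
    using assms
    by (auto simp: exponents_def in_keys_iff lookup_minus lookup_single when_def subset_iff
        less_Suc_eq split: if_splits)
  show "u = ?v + Poly_Mapping.single n (Poly_Mapping.lookup u n)"
    by (rule poly_mapping_eqI) (auto simp: lookup_minus lookup_add lookup_single when_def)
qed

section \<open>Homogenization\<close>

text \<open>All terms of f_t have the same total weight \<open>?D\<close>, so the toric image of f_t
  is that of f shifted by \<open>?D\<close> in the new coordinate, hence 0.\<close>

lemma homogenize_in_toric_ideal:
  assumes "f \<in> toric_ideal d n a"
  shows "homogenize n w f \<in> toric_ideal (Suc d) (Suc n) (weighted_config d n a w)"
proof -
  let ?D = "weight_degree n w f"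
  have keys: "Poly_Mapping.keys f \<subseteq> exponents n" and zero: "pushforward (config_degree a) f = 0"
    using assms by (simp_all add: in_toric_ideal_iff)
  have "pushforward (config_degree (weighted_config d n a w)) (homogenize n w f) =
      (\<Sum>u\<in>Poly_Mapping.keys f. Poly_Mapping.single
        (config_degree a u + Poly_Mapping.single d (int ?D)) (Poly_Mapping.lookup f u))"
    unfolding homogenize_def pushforward_sum pushforward_single
  proof (rule sum.cong)
    fix u assume u: "u \<in> Poly_Mapping.keys f"
    \<comment> \<open>The bound makes the subtraction of natural numbers exact, so weight and power
      of t add up to \<open>?D\<close>.\<close>
    then have "weight n w u \<le> ?D"
      by (simp add: weight_degree_def)
    with u keys show "Poly_Mapping.single (config_degree (weighted_config d n a w)
          (u + Poly_Mapping.single n (?D - weight n w u))) (Poly_Mapping.lookup f u) =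
        Poly_Mapping.single (config_degree a u + Poly_Mapping.single d (int ?D))
          (Poly_Mapping.lookup f u)"
      by (subst config_degree_weighted_config) auto
  qed simp
  also have "\<dots> = pushforward (\<lambda>v. v + Poly_Mapping.single d (int ?D))
      (pushforward (config_degree a) f)"
    unfolding pushforward_pushforward by (simp only: pushforward_def)
  finally show ?thesis
    using homogenize_closed[of f n w] keys zero
    by (simp add: in_toric_ideal_iff exponent_algebra_def)
qed

text \<open>For distinct exponents nothing cancels: both are keys, and the weight degree is the
  larger of the two weights.\<close>

lemma homogenize_binomial:
  fixes n :: nat and w :: "nat \<Rightarrow> nat" and u v :: "nat \<Rightarrow>\<^sub>0 nat"
  assumes "u \<noteq> v"
  defines "D \<equiv> max (weight n w u) (weight n w v)"
  shows "homogenize n w (Poly_Mapping.single u 1 - Poly_Mapping.single v (1::'k::field)) =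
    Poly_Mapping.single (u + Poly_Mapping.single n (D - weight n w u)) 1 -
    Poly_Mapping.single (v + Poly_Mapping.single n (D - weight n w v)) 1"
proof -
  let ?f = "Poly_Mapping.single u 1 - Poly_Mapping.single v (1::'k)"
  have keys: "Poly_Mapping.keys ?f = {u, v}"
    using assms(1) by (auto simp: in_keys_iff lookup_minus lookup_single when_def split: if_splits)
  then have "weight_degree n w ?f = D"
    by (simp add: weight_degree_def D_def)
  then show ?thesis
    using assms(1) by (simp add: homogenize_def keys lookup_minus lookup_single single_uminus)
qed

section \<open>Ideals and the degeneration\<close>

lemma ideal_groebner_degeneration:
  fixes J :: "(_ \<Rightarrow>\<^sub>0 'k::field) set"
  assumes "J \<subseteq> carrier (poly_ring n)"
  shows "ideal (groebner_degeneration n w J) (poly_ring (Suc n))"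
    and "homogenize n w ` J \<subseteq> groebner_degeneration n w J"
proof -
  interpret cring "poly_ring (Suc n) :: (_ \<Rightarrow>\<^sub>0 'k) ring"
    by (rule cring_exponent_algebra)
  have "homogenize n w ` J \<subseteq> carrier (poly_ring (Suc n))"
    using assms homogenize_closed by blast
  then show "ideal (groebner_degeneration n w J) (poly_ring (Suc n))"
    and "homogenize n w ` J \<subseteq> groebner_degeneration n w J"
    unfolding groebner_degeneration_def by (rule genideal_ideal, rule genideal_self)
qed

lemma ideal_exponent_algebraD:
  assumes "ideal I (exponent_algebra m)"
  shows "0 \<in> I"
    and "f \<in> I \<Longrightarrow> g \<in> I \<Longrightarrow> f + g \<in> I"
    and "f \<in> I \<Longrightarrow> Poly_Mapping.keys g \<subseteq> exponents m \<Longrightarrow> g * f \<in> I"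
  using additive_subgroup.zero_closed[OF ideal.axioms(1)[OF assms]]
    additive_subgroup.a_closed[OF ideal.axioms(1)[OF assms], of f g]
    ideal.I_l_closed[OF assms, of f g]
  by (simp_all add: exponent_algebra_def)

lemma ideal_exponent_algebra_sum:
  assumes "ideal I (exponent_algebra m)" "\<And>x. x \<in> A \<Longrightarrow> F x \<in> I"
  shows "sum F A \<in> I"
  using assms(2)
  by (induction A rule: infinite_finite_induct) (simp_all add: ideal_exponent_algebraD[OF assms(1)])

text \<open>Without their powers of t, the two monomials still have equal degree under
  \<open>a\<close>, so their difference lies in the original toric ideal. Its homogenization differs
  from the given binomial only by a power of t.\<close>

lemma binomial_in_groebner_degeneration:
  fixes a :: "nat \<Rightarrow> (nat \<Rightarrow>\<^sub>0 int)"
  assumes a: "\<And>i. i < n \<Longrightarrow> a i \<in> exponents d"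
    and u: "u \<in> exponents (Suc n)" and v: "v \<in> exponents (Suc n)"
    and eq: "config_degree (weighted_config d n a w) u = config_degree (weighted_config d n a w) v"
  shows "Poly_Mapping.single u 1 - Poly_Mapping.single v (1::'k::field)
    \<in> groebner_degeneration n w (toric_ideal d n a)" (is "_ \<in> ?J")
proof -
  have sub: "toric_ideal d n a \<subseteq> carrier (poly_ring n :: (_ \<Rightarrow>\<^sub>0 'k) ring)"
    by (auto simp: in_toric_ideal_iff exponent_algebra_def)
  note ideal = ideal_groebner_degeneration[OF sub, of w]
  obtain u' j where u': "u' \<in> exponents n" "u = u' + Poly_Mapping.single n j"
    using u by (rule exponents_Suc_decompose)
  obtain v' k where v': "v' \<in> exponents n" "v = v' + Poly_Mapping.single n k"
    using v by (rule exponents_Suc_decompose)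
  have eq': "config_degree a u' + Poly_Mapping.single d (int (weight n w u' + j)) =
      config_degree a v' + Poly_Mapping.single d (int (weight n w v' + k))"
    using eq u' v' by (simp only: config_degree_weighted_config)
  \<comment> \<open>The vectors \<open>a i\<close> only use coordinates below \<open>d\<close>, so
    comparing coordinate \<open>d\<close> isolates the total weights.\<close>
  have "Poly_Mapping.lookup (config_degree a x) d = 0" if "x \<in> exponents n" for x
    using config_degree_closed[of n a d x] a that by (auto simp: exponents_def in_keys_iff)
  then have e: "weight n w u' + j = weight n w v' + k"
    using arg_cong[OF eq', of "\<lambda>x. Poly_Mapping.lookup x d"] u' v'
    by (simp add: lookup_add lookup_single)
  then have deg: "config_degree a u' = config_degree a v'"
    using eq' by simp
  show ?thesis
  proof (cases "u' = v'")
    case True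
    then show ?thesis
      using e u' v' ideal_exponent_algebraD(1)[OF ideal(1)] by simp
  next
    case False
    let ?f = "Poly_Mapping.single u' 1 - Poly_Mapping.single v' (1::'k)"
    define D where "D = max (weight n w u') (weight n w v')"
    \<comment> \<open>The common total weight is at least \<open>D\<close>, so the exponent is a
      true difference; it equals the minimum of \<open>j\<close> and \<open>k\<close>.\<close>
    define t where
      "t = Poly_Mapping.single (Poly_Mapping.single n (weight n w u' + j - D)) (1::'k)"
    \<comment> \<open>Adding the second monomial back reduces the difference to additivity.\<close>
    have "pushforward (config_degree a) (?f + Poly_Mapping.single v' 1) =
        pushforward (config_degree a) ?f + Poly_Mapping.single (config_degree a v') 1"
      by (simp only: pushforward_add pushforward_single)
    then have "pushforward (config_degree a) ?f = 0"
      using deg by simp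
    moreover have "Poly_Mapping.keys ?f \<subseteq> exponents n"
      using keys_diff[of "Poly_Mapping.single u' 1" "Poly_Mapping.single v' (1::'k)"] u' v' by auto
    ultimately have "?f \<in> toric_ideal d n a"
      by (simp add: in_toric_ideal_iff)
    then have "homogenize n w ?f \<in> ?J"
      using ideal(2) by blast
    moreover have "Poly_Mapping.keys t \<subseteq> exponents (Suc n)"
      by (simp add: t_def exponents_def)
    ultimately have "t * homogenize n w ?f \<in> ?J"
      by (rule ideal_exponent_algebraD(3)[OF ideal(1)])
    moreover have "t * homogenize n w ?f = Poly_Mapping.single u 1 - Poly_Mapping.single v 1"
    proof -
      have "weight n w u' + j - D + (D - weight n w u') = j"
        "weight n w u' + j - D + (D - weight n w v') = k"
        using e by (auto simp: D_def)
      then have "Poly_Mapping.single n (weight n w u' + j - D) +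
          (u' + Poly_Mapping.single n (D - weight n w u')) = u"
        "Poly_Mapping.single n (weight n w u' + j - D) +
          (v' + Poly_Mapping.single n (D - weight n w v')) = v"
        by (simp_all only: u' v' add.left_commute flip: single_add)
      then show ?thesis
        unfolding homogenize_binomial[OF False] t_def D_def[symmetric]
        by (simp add: right_diff_distrib mult_single)
    qed
    ultimately show ?thesis by simp
  qed
qed

section \<open>The two inclusions\<close>

theorem theorem1p2:
  fixes n d :: nat
    and a :: "nat \<Rightarrow> (nat \<Rightarrow>\<^sub>0 int)"
    and w :: "nat \<Rightarrow> nat"
  assumes "\<And>i. i < n \<Longrightarrow> a i \<in> exponents d"
  shows "groebner_degeneration n w (toric_ideal d n a) =
    (toric_ideal (Suc d) (Suc n) (weighted_config d n a w)
      :: ((nat \<Rightarrow>\<^sub>0 nat) \<Rightarrow>\<^sub>0 'k::field) set)"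
    (is "?J = ?I")
proof
  interpret cring "poly_ring (Suc n) :: (_ \<Rightarrow>\<^sub>0 'k) ring"
    by (rule cring_exponent_algebra)
  have "ideal ?I (poly_ring (Suc n))"
    using assms by (intro ideal_toric_ideal weighted_config_closed)
  then show "?J \<subseteq> ?I"
    unfolding groebner_degeneration_def
    by (rule genideal_minimal) (auto intro: homogenize_in_toric_ideal)
next
  have sub: "toric_ideal d n a \<subseteq> carrier (poly_ring n :: (_ \<Rightarrow>\<^sub>0 'k) ring)"
    by (auto simp: in_toric_ideal_iff exponent_algebra_def)
  note ideal = ideal_groebner_degeneration(1)[OF sub, of w]
  show "?I \<subseteq> ?J"
  proof
    fix g assume "g \<in> ?I"
    let ?deg = "config_degree (weighted_config d n a w)"
    let ?K = "Poly_Mapping.keys g"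
    \<comment> \<open>\<open>r\<close> picks one key of \<open>g\<close> in each degree that occurs;
      its values at other degrees do not enter the sums below.\<close>
    define r where "r v = inv_into ?K ?deg v" for v
    have keys: "?K \<subseteq> exponents (Suc n)" and zero: "pushforward ?deg g = 0"
      using \<open>g \<in> ?I\<close> by (simp_all add: in_toric_ideal_iff)
    have r: "r (?deg u) \<in> ?K" "?deg (r (?deg u)) = ?deg u" if "u \<in> ?K" for u
      using that by (simp_all add: r_def inv_into_into f_inv_into_f)
    \<comment> \<open>Moving every term to its representative factors through the toric image of
      \<open>g\<close>, which is 0. Subtracting this sum therefore leaves \<open>g\<close> unchanged
      and pairs each term with its representative.\<close>
    have "(\<Sum>u\<in>?K. Poly_Mapping.single (r (?deg u)) (Poly_Mapping.lookup g u)) =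
        pushforward r (pushforward ?deg g)"
      unfolding pushforward_pushforward by (simp only: pushforward_def)
    then have "g = (\<Sum>u\<in>?K. Poly_Mapping.single u (Poly_Mapping.lookup g u)) -
        (\<Sum>u\<in>?K. Poly_Mapping.single (r (?deg u)) (Poly_Mapping.lookup g u))"
      using zero sum_singles[of g] by simp
    also have "\<dots> = (\<Sum>u\<in>?K. Poly_Mapping.single 0 (Poly_Mapping.lookup g u) *
        (Poly_Mapping.single u 1 - Poly_Mapping.single (r (?deg u)) 1))"
      by (simp add: sum_subtractf right_diff_distrib mult_single)
    also have "\<dots> \<in> ?J"
    proof (rule ideal_exponent_algebra_sum[OF ideal])
      fix u assume "u \<in> ?K"
      then have "Poly_Mapping.single u 1 - Poly_Mapping.single (r (?deg u)) 1 \<in> ?J"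
        using assms keys r by (intro binomial_in_groebner_degeneration) auto
      then show "Poly_Mapping.single 0 (Poly_Mapping.lookup g u) *
          (Poly_Mapping.single u 1 - Poly_Mapping.single (r (?deg u)) 1) \<in> ?J"
        by (rule ideal_exponent_algebraD(3)[OF ideal]) simp
    qed
    finally show "g \<in> ?J" .
  qed
qed

end
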